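(* Let $K$ be a field, let $F$ be a field extension of $K$ of transcendence degree $n$, and let $t_1,\dots,t_n$ and $s_1,\dots,s_n$ be two separating transcendence bases of $F$ over $K$. Let $\theta_{\boldsymbol t}$ and $\theta_{\boldsymbol s}$ be the higher derivations on $F$ with respect to $\boldsymbol t=(t_1,\dots,t_n)$ and $\boldsymbol s=(s_1,\dots,s_n)$. Then for every $g\in F$, in $F[[T_1,\dots,T_n]]$, $$\theta_{\boldsymbol s}(g)=\theta_{\boldsymbol t}(g)|_{\boldsymbol T=\theta_{\boldsymbol s}(\boldsymbol t)-\boldsymbol t}=\sum_{\boldsymbol\mu\in\mathbb N^n}\theta_{\boldsymbol t}^{(\boldsymbol\mu)}(g)\cdot\prod_{j=1}^n\Bigl(\sum_{\boldsymbol\nu\in\mathbb N^n,\ \boldsymbol\nu\ne\boldsymbol 0}\theta_{\boldsymbol s}^{(\boldsymbol\nu)}(t_j)\,\boldsymbol T^{\boldsymbol\nu}\Bigr)^{\mu_j}.$$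
   Context: $\mathbb N$ contains $0$; multi-index notation is used. An $n$-variate higher derivation on a commutative ring $R$ is a ring homomorphism $\theta:R\to R[[T_1,\dots,T_n]]$ with $\theta(r)|_{\boldsymbol T=\boldsymbol 0}=r$ for all $r\in R$; $\theta^{(\boldsymbol\alpha)}(r)$ denotes the coefficient of $\boldsymbol T^{\boldsymbol\alpha}$ in $\theta(r)$. A separating transcendence basis of $F$ over $K$ is a transcendence basis $t_1,\dots,t_n$ such that $F$ is a separable algebraic extension of $K(t_1,\dots,t_n)$. For such a basis, $\theta_{\boldsymbol t}$ is the $n$-variate higher derivation on $K[t_1,\dots,t_n]$ that is the $K$-algebra homomorphism with $\theta_{\boldsymbol t}(t_i)=t_i+T_i$; higher derivations extend uniquely along localizations and separable algebraic field extensions, and the unique extension to $F$ is again denoted $\theta_{\boldsymbol t}:F\to F[[T_1,\dots,T_n]]$. Likewise $\theta_{\boldsymbol s}$. The notation $|_{\boldsymbol T=\theta_{\boldsymbol s}(\boldsymbol t)-\boldsymbol t}$ means substituting the power series $\theta_{\boldsymbol s}(t_j)-t_j$ (which has zero constant term) for $T_j$, $j=1,\dots,n$. *)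

theory Defs
  imports
    "HOL-Library.Poly_Mapping"
    "HOL-Computational_Algebra.Polynomial"
    "HOL-Algebra.Generated_Fields"
    "HOL-Algebra.Algebraic_Closure_Type"
begin

section \<open>Multivariate formal power series\<close>

text \<open>
  Multi-indices are finitely supported functions on \<open>nat\<close>, so that one type serves every
  number \<open>n\<close> of variables (including \<open>n = 0\<close>).  The variables \<open>T\<^sub>1, \<dots>, T\<^sub>n\<close> are
  numbered \<open>0, \<dots>, n - 1\<close>.
\<close>

type_synonym multi_index = "nat \<Rightarrow>\<^sub>0 nat"

definition multi_indices :: "nat \<Rightarrow> multi_index set" where
  "multi_indices n = {\<alpha>. Poly_Mapping.keys \<alpha> \<subseteq> {..<n}}"

definition splittings :: "multi_index \<Rightarrow> (multi_index \<times> multi_index) set" where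
  "splittings \<alpha> = {(\<beta>, \<gamma>). \<beta> + \<gamma> = \<alpha>}"

lemma finite_splittings [simp, intro]: "finite (splittings \<alpha>)"
proof -
  let ?A = "Poly_Mapping.keys \<alpha>"
  let ?B = "{..Max (insert 0 (Poly_Mapping.lookup \<alpha> ` ?A))}"
  let ?F = "{f. \<forall>i. (i \<in> ?A \<longrightarrow> f i \<in> ?B) \<and> (i \<notin> ?A \<longrightarrow> f i = (0::nat))}"
  have finF: "finite ?F"
    by (rule finite_set_of_finite_funs) auto
  have F: "Poly_Mapping.lookup \<beta> \<in> ?F" if "\<beta> + \<gamma> = \<alpha>" for \<beta> \<gamma>
  proof -
    have le: "Poly_Mapping.lookup \<beta> i \<le> Poly_Mapping.lookup \<alpha> i" for i
      using that by (auto simp: lookup_add)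
    show ?thesis
    proof (clarify, intro conjI impI)
      fix i assume "i \<in> ?A"
      then have "Poly_Mapping.lookup \<alpha> i \<in> ?B" by (auto intro: Max_ge)
      with le[of i] show "Poly_Mapping.lookup \<beta> i \<in> ?B" by (meson atMost_iff le_trans)
    next
      fix i assume "i \<notin> ?A"
      with le[of i] show "Poly_Mapping.lookup \<beta> i = 0" by (simp add: in_keys_iff)
    qed
  qed
  have "Poly_Mapping.lookup ` fst ` splittings \<alpha> \<subseteq> ?F"
  proof (intro image_subsetI)
    fix \<beta> assume "\<beta> \<in> fst ` splittings \<alpha>"
    then obtain \<gamma> where "\<beta> + \<gamma> = \<alpha>"
      by (auto simp: splittings_def)
    then show "Poly_Mapping.lookup \<beta> \<in> ?F"
      by (rule F)
  qed
  then have "finite (Poly_Mapping.lookup ` fst ` splittings \<alpha>)"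
    using finF by (rule finite_subset)
  then have fin: "finite (fst ` splittings \<alpha>)"
    by (rule finite_imageD) (intro inj_onI poly_mapping_eqI, rule fun_cong)
  have "splittings \<alpha> \<subseteq> (\<lambda>\<beta>. (\<beta>, \<alpha> - \<beta>)) ` fst ` splittings \<alpha>"
  proof
    fix p assume p: "p \<in> splittings \<alpha>"
    then have "p = (\<lambda>\<beta>. (\<beta>, \<alpha> - \<beta>)) (fst p)"
      by (cases p) (auto simp: splittings_def)
    with p show "p \<in> (\<lambda>\<beta>. (\<beta>, \<alpha> - \<beta>)) ` fst ` splittings \<alpha>"
      by (metis imageI)
  qed
  then show ?thesis
    by (rule finite_subset) (intro finite_imageI fin)
qed

text \<open>
  The type consists of the power series in countably many variables; \<open>R[[T\<^sub>1, \<dots>, T\<^sub>n]]\<close> is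
  its subring \<open>mfps_carrier n\<close> below.
\<close>

typedef 'a mfps = "UNIV :: (multi_index \<Rightarrow> 'a) set"
  morphisms mfps_nth Abs_mfps by simp

setup_lifting type_definition_mfps

lemma mfps_eqI: "(\<And>\<alpha>. mfps_nth f \<alpha> = mfps_nth g \<alpha>) \<Longrightarrow> f = g"
  by transfer auto

instantiation mfps :: (comm_ring_1) comm_ring_1
begin

lift_definition zero_mfps :: "'a mfps" is "\<lambda>_. 0" .
lift_definition one_mfps :: "'a mfps" is "\<lambda>\<alpha>. if \<alpha> = 0 then 1 else 0" .
lift_definition plus_mfps :: "'a mfps \<Rightarrow> 'a mfps \<Rightarrow> 'a mfps" is "\<lambda>f g \<alpha>. f \<alpha> + g \<alpha>" .
lift_definition minus_mfps :: "'a mfps \<Rightarrow> 'a mfps \<Rightarrow> 'a mfps" is "\<lambda>f g \<alpha>. f \<alpha> - g \<alpha>" .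
lift_definition uminus_mfps :: "'a mfps \<Rightarrow> 'a mfps" is "\<lambda>f \<alpha>. - f \<alpha>" .
lift_definition times_mfps :: "'a mfps \<Rightarrow> 'a mfps \<Rightarrow> 'a mfps" is
  "\<lambda>f g \<alpha>. \<Sum>(\<beta>, \<gamma>)\<in>splittings \<alpha>. f \<beta> * g \<gamma>" .

instance
proof
  fix f g h :: "'a mfps"
  show "f + g + h = f + (g + h)" by transfer (simp add: add.assoc)
  show "f + g = g + f" by transfer (simp add: add.commute)
  show "0 + f = f" by transfer simp
  show "- f + f = 0" by transfer simp
  show "f - g = f + - g" by transfer simp
  show "(0::'a mfps) \<noteq> 1" by transfer (auto simp: fun_eq_iff)
  show "(f + g) * h = f * h + g * h"
    by transfer (simp add: algebra_simps sum.distrib case_prod_unfold)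
  show "f * g = g * f"
  proof (transfer, rule ext)
    fix f g :: "multi_index \<Rightarrow> 'a" and \<alpha>
    show "(\<Sum>(\<beta>, \<gamma>)\<in>splittings \<alpha>. f \<beta> * g \<gamma>) = (\<Sum>(\<beta>, \<gamma>)\<in>splittings \<alpha>. g \<beta> * f \<gamma>)"
      by (rule sum.reindex_bij_witness[of _ prod.swap prod.swap])
         (auto simp: splittings_def ac_simps)
  qed
  show "1 * f = f"
  proof (transfer, rule ext)
    fix f :: "multi_index \<Rightarrow> 'a" and \<alpha>
    have "(\<Sum>(\<beta>, \<gamma>)\<in>splittings \<alpha>. (if \<beta> = 0 then 1 else 0) * f \<gamma>)
          = (\<Sum>(\<beta>, \<gamma>)\<in>{(0::multi_index, \<alpha>)}. (if \<beta> = 0 then 1 else 0) * f \<gamma>)"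
      by (rule sum.mono_neutral_right[OF finite_splittings])
         (auto simp: splittings_def split: if_splits)
    then show "(\<Sum>(\<beta>, \<gamma>)\<in>splittings \<alpha>. (if \<beta> = 0 then 1 else 0) * f \<gamma>) = f \<alpha>"
      by simp
  qed
  show "f * g * h = f * (g * h)"
  proof (transfer, rule ext)
    fix f g h :: "multi_index \<Rightarrow> 'a" and \<alpha>
    have "(\<Sum>(\<beta>, \<gamma>)\<in>splittings \<alpha>. (\<Sum>(\<delta>, \<epsilon>)\<in>splittings \<beta>. f \<delta> * g \<epsilon>) * h \<gamma>)
          = (\<Sum>(p, q)\<in>Sigma (splittings \<alpha>) (\<lambda>p. splittings (fst p)).
               f (fst q) * g (snd q) * h (snd p))"
      by (simp add: sum.Sigma sum_distrib_right case_prod_unfold)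
    also have "\<dots> = (\<Sum>(p, q)\<in>Sigma (splittings \<alpha>) (\<lambda>p. splittings (snd p)).
               f (fst p) * (g (fst q) * h (snd q)))"
      by (rule sum.reindex_bij_witness
            [of _ "\<lambda>(p, q). ((fst p + fst q, snd q), (fst p, fst q))"
                  "\<lambda>(p, q). ((fst q, snd q + snd p), (snd q, snd p))"])
         (auto simp: splittings_def add.assoc mult.assoc)
    also have "\<dots> = (\<Sum>(\<beta>, \<gamma>)\<in>splittings \<alpha>. f \<beta> * (\<Sum>(\<delta>, \<epsilon>)\<in>splittings \<gamma>. g \<delta> * h \<epsilon>))"
      by (simp add: sum.Sigma sum_distrib_left case_prod_unfold)
    finally show "(\<Sum>(\<beta>, \<gamma>)\<in>splittings \<alpha>. (\<Sum>(\<delta>, \<epsilon>)\<in>splittings \<beta>. f \<delta> * g \<epsilon>) * h \<gamma>)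
          = (\<Sum>(\<beta>, \<gamma>)\<in>splittings \<alpha>. f \<beta> * (\<Sum>(\<delta>, \<epsilon>)\<in>splittings \<gamma>. g \<delta> * h \<epsilon>))" .
  qed
qed

end

definition mfps_monom :: "'a::comm_ring_1 \<Rightarrow> multi_index \<Rightarrow> 'a mfps" where
  "mfps_monom c \<mu> = Abs_mfps (\<lambda>\<alpha>. if \<alpha> = \<mu> then c else 0)"

lemma mfps_nth_monom: "mfps_nth (mfps_monom c \<mu>) \<alpha> = (if \<alpha> = \<mu> then c else 0)"
  by (simp add: mfps_monom_def Abs_mfps_inverse)

definition mfps_const :: "'a::comm_ring_1 \<Rightarrow> 'a mfps" where
  "mfps_const c = mfps_monom c 0"

definition mfps_X :: "nat \<Rightarrow> 'a::comm_ring_1 mfps" where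
  "mfps_X i = mfps_monom 1 (Poly_Mapping.single i 1)"

definition mfps_carrier :: "nat \<Rightarrow> 'a::comm_ring_1 mfps set" where
  "mfps_carrier n = {f. \<forall>\<alpha>. \<alpha> \<notin> multi_indices n \<longrightarrow> mfps_nth f \<alpha> = 0}"

text \<open>
  Infinite sums of power series.  A family is summable if every coefficient receives only
  finitely many nonzero contributions; its sum is then taken coefficientwise.
\<close>

definition mfps_summable :: "('b \<Rightarrow> 'a::comm_ring_1 mfps) \<Rightarrow> 'b set \<Rightarrow> bool" where
  "mfps_summable f A \<longleftrightarrow> (\<forall>\<alpha>. finite {a \<in> A. mfps_nth (f a) \<alpha> \<noteq> 0})"

definition mfps_sum :: "('b \<Rightarrow> 'a::comm_ring_1 mfps) \<Rightarrow> 'b set \<Rightarrow> 'a mfps" where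
  "mfps_sum f A = Abs_mfps (\<lambda>\<alpha>. \<Sum>a\<in>{a \<in> A. mfps_nth (f a) \<alpha> \<noteq> 0}. mfps_nth (f a) \<alpha>)"

definition mfps_has_sum :: "('b \<Rightarrow> 'a::comm_ring_1 mfps) \<Rightarrow> 'b set \<Rightarrow> 'a mfps \<Rightarrow> bool" where
  "mfps_has_sum f A S \<longleftrightarrow> mfps_summable f A \<and> mfps_sum f A = S"

lemma mfps_summable_monom: "mfps_summable (\<lambda>\<nu>. mfps_monom (c \<nu>) \<nu>) A"
  unfolding mfps_summable_def
  by (intro allI finite_subset[OF _ finite.insertI[OF finite.emptyI]])
     (auto simp: mfps_nth_monom)

lemma mfps_nth_sum_monom:
  "mfps_nth (mfps_sum (\<lambda>\<nu>. mfps_monom (c \<nu>) \<nu>) A) \<alpha> = (if \<alpha> \<in> A then c \<alpha> else 0)"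
proof -
  have "{\<nu> \<in> A. mfps_nth (mfps_monom (c \<nu>) \<nu>) \<alpha> \<noteq> 0}
        = (if \<alpha> \<in> A \<and> c \<alpha> \<noteq> 0 then {\<alpha>} else {})"
    by (auto simp: mfps_nth_monom)
  then show ?thesis
    unfolding mfps_sum_def Abs_mfps_inverse[OF UNIV_I]
    by (simp add: mfps_nth_monom)
qed

text \<open>
  \<open>f|\<^bsub>T = u\<^esub>\<close>, meaningful for \<open>f \<in> R[[T\<^sub>1, \<dots>, T\<^sub>n]]\<close> and \<open>u\<^sub>1, \<dots>, u\<^sub>n\<close> with zero
  constant terms, in which case the sum below is summable.
\<close>

definition mfps_subst ::
  "nat \<Rightarrow> 'a::comm_ring_1 mfps \<Rightarrow> (nat \<Rightarrow> 'a mfps) \<Rightarrow> 'a mfps" where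
  "mfps_subst n f u =
     mfps_sum (\<lambda>\<mu>. mfps_const (mfps_nth f \<mu>) * (\<Prod>j<n. u j ^ Poly_Mapping.lookup \<mu> j))
       (multi_indices n)"

section \<open>Higher derivations\<close>

definition higher_derivation :: "nat \<Rightarrow> ('a::comm_ring_1 \<Rightarrow> 'a mfps) \<Rightarrow> bool" where
  "higher_derivation n \<theta> \<longleftrightarrow>
     (\<forall>r. \<theta> r \<in> mfps_carrier n) \<and>
     \<theta> 1 = 1 \<and> (\<forall>r s. \<theta> (r + s) = \<theta> r + \<theta> s) \<and> (\<forall>r s. \<theta> (r * s) = \<theta> r * \<theta> s) \<and>
     (\<forall>r. mfps_nth (\<theta> r) 0 = r)"

section \<open>Separating transcendence bases\<close>

text \<open>
  The field \<open>F\<close> is a type of class \<open>field\<close>, and its subfields are sets, with the notions of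
  \<open>HOL-Algebra\<close> transported along \<open>ring_of_type_algebra\<close>.
\<close>

abbreviation is_subfield :: "'a::field set \<Rightarrow> bool" where
  "is_subfield K \<equiv> subfield K (ring_of_type_algebra :: 'a ring)"

definition adjoin :: "'a::field set \<Rightarrow> 'a set \<Rightarrow> 'a set" where
  "adjoin K S = generate_field (ring_of_type_algebra :: 'a ring) (K \<union> S)"

definition min_poly_over :: "'a::field set \<Rightarrow> 'a \<Rightarrow> 'a poly \<Rightarrow> bool" where
  "min_poly_over L x p \<longleftrightarrow>
     lead_coeff p = 1 \<and> (\<forall>i. poly.coeff p i \<in> L) \<and> poly p x = 0 \<and>
     (\<forall>q. q \<noteq> 0 \<longrightarrow> (\<forall>i. poly.coeff q i \<in> L) \<longrightarrow> poly q x = 0 \<longrightarrow> 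
          Polynomial.degree p \<le> Polynomial.degree q)"

text \<open>
  \<open>x\<close> is separable algebraic over \<open>L\<close>: it has a minimal polynomial over \<open>L\<close>, and this has no
  multiple roots in an algebraic closure.
\<close>

definition separable_over :: "'a::field set \<Rightarrow> 'a \<Rightarrow> bool" where
  "separable_over L x \<longleftrightarrow> (\<exists>p. min_poly_over L x p \<and> rsquarefree (map_poly to_ac p))"

definition mpoly_eval :: "(nat \<Rightarrow> 'a::comm_ring_1) \<Rightarrow> (multi_index \<Rightarrow>\<^sub>0 'a) \<Rightarrow> 'a" where
  "mpoly_eval t P =
     (\<Sum>\<mu>\<in>Poly_Mapping.keys P. Poly_Mapping.lookup P \<mu> *
        (\<Prod>i\<in>Poly_Mapping.keys \<mu>. t i ^ Poly_Mapping.lookup \<mu> i))"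

definition alg_independent :: "'a::field set \<Rightarrow> nat \<Rightarrow> (nat \<Rightarrow> 'a) \<Rightarrow> bool" where
  "alg_independent K n t \<longleftrightarrow>
     (\<forall>P :: multi_index \<Rightarrow>\<^sub>0 'a.
        Poly_Mapping.keys P \<subseteq> multi_indices n \<and> (\<forall>\<mu>. Poly_Mapping.lookup P \<mu> \<in> K) \<and>
        mpoly_eval t P = 0 \<longrightarrow> P = 0)"

text \<open>
  The family \<open>t 0, \<dots>, t (n - 1)\<close> is a separating transcendence basis of the whole field over
  \<open>K\<close>; separability includes algebraicity over \<open>K(t)\<close>.
\<close>

definition separating_transcendence_basis ::
  "'a::field set \<Rightarrow> nat \<Rightarrow> (nat \<Rightarrow> 'a) \<Rightarrow> bool" where
  "separating_transcendence_basis K n t \<longleftrightarrow>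
     alg_independent K n t \<and> (\<forall>x. separable_over (adjoin K (t ` {..<n})) x)"

text \<open>
  \<open>\<theta>\<close> is the higher derivation \<open>\<theta>\<^sub>t\<close> on \<open>F\<close>: it extends the \<open>K\<close>-algebra homomorphism on
  \<open>K[t]\<close> with \<open>t\<^sub>i \<mapsto> t\<^sub>i + T\<^sub>i\<close>.  If \<open>t\<close> is a separating transcendence basis, there is
  exactly one such \<open>\<theta>\<close>.
\<close>

definition basis_derivation ::
  "'a::field set \<Rightarrow> nat \<Rightarrow> (nat \<Rightarrow> 'a) \<Rightarrow> ('a \<Rightarrow> 'a mfps) \<Rightarrow> bool" where
  "basis_derivation K n t \<theta> \<longleftrightarrow>
     higher_derivation n \<theta> \<and> (\<forall>c\<in>K. \<theta> c = mfps_const c) \<and>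
     (\<forall>i<n. \<theta> (t i) = mfps_const (t i) + mfps_X i)"

end

theory Submission
  imports Defs
begin

text \<open>
  Substituting \<open>\<theta>\<^sub>s(t) - t\<close> into \<open>\<theta>\<^sub>t\<close> yields a ring homomorphism \<open>F \<rightarrow> F[[T]]\<close> which, like
  \<open>\<theta>\<^sub>s\<close>, is the identity modulo \<open>T\<close> and which agrees with \<open>\<theta>\<^sub>s\<close> on \<open>K\<close> and on the \<open>t\<^sub>j\<close>.  Two
  such homomorphisms that agree on \<open>K \<union> {t\<^sub>1, \<dots>, t\<^sub>n}\<close> agree on \<open>K(t)\<close>.  If \<open>p\<close> is the minimal
  polynomial of \<open>x\<close> over \<open>K(t)\<close>, then comparing the images of \<open>p(x) = 0\<close> gives
  \<open>(\<phi>(x) - \<psi>(x)) c = 0\<close> where \<open>c\<close> has constant term \<open>p'(x) \<noteq> 0\<close>, so \<open>\<phi>(x) = \<psi>(x)\<close>.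
\<close>

section \<open>Total degree and order of vanishing\<close>

definition mdeg :: "multi_index \<Rightarrow> nat" where
  "mdeg \<alpha> = (\<Sum>i\<in>Poly_Mapping.keys \<alpha>. Poly_Mapping.lookup \<alpha> i)"

lemma mdeg_add: "mdeg (\<alpha> + \<beta>) = mdeg \<alpha> + mdeg \<beta>"
  unfolding mdeg_def by (rule setsum_keys_plus_distrib) auto

lemma mdeg_eq_0_iff [simp]: "mdeg \<alpha> = 0 \<longleftrightarrow> \<alpha> = 0"
  by (auto simp: mdeg_def in_keys_iff intro: poly_mapping_eqI)

lemma mdeg_pos_iff [simp]: "0 < mdeg \<alpha> \<longleftrightarrow> \<alpha> \<noteq> 0"
  using mdeg_eq_0_iff[of \<alpha>] by linarith

lemma lookup_le_mdeg: "Poly_Mapping.lookup \<alpha> i \<le> mdeg \<alpha>"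
proof (cases "i \<in> Poly_Mapping.keys \<alpha>")
  case True
  then show ?thesis
    unfolding mdeg_def by (intro member_le_sum) auto
qed (simp add: in_keys_iff)

lemma mdeg_eq_sum:
  assumes "\<mu> \<in> multi_indices n"
  shows "mdeg \<mu> = (\<Sum>i<n. Poly_Mapping.lookup \<mu> i)"
  unfolding mdeg_def
  by (rule sum.mono_neutral_left) (use assms in \<open>auto simp: multi_indices_def in_keys_iff\<close>)

text \<open>Exponents lie in \<open>{..d}\<close> and the support in \<open>{..<n}\<close>. Fixing
  \<open>n\<close> is essential: with infinitely many variables there are infinitely many indices of
  degree 1.\<close>

lemma finite_multi_indices_mdeg_le: "finite {\<mu> \<in> multi_indices n. mdeg \<mu> \<le> d}"
proof -
  let ?F = "{f. \<forall>i. (i \<in> {..<n} \<longrightarrow> f i \<in> {..d}) \<and> (i \<notin> {..<n} \<longrightarrow> f i = (0::nat))}"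
  have "finite ?F"
    by (rule finite_set_of_finite_funs) auto
  moreover have "Poly_Mapping.lookup ` {\<mu> \<in> multi_indices n. mdeg \<mu> \<le> d} \<subseteq> ?F"
    by (auto simp: multi_indices_def in_keys_iff intro: order_trans[OF lookup_le_mdeg])
  ultimately have "finite (Poly_Mapping.lookup ` {\<mu> \<in> multi_indices n. mdeg \<mu> \<le> d})"
    by (rule finite_subset[rotated])
  then show ?thesis
    by (rule finite_imageD) (intro inj_onI poly_mapping_eqI, rule fun_cong)
qed

lemma multi_indices_add_iff:
  "\<mu> + \<nu> \<in> multi_indices n \<longleftrightarrow> \<mu> \<in> multi_indices n \<and> \<nu> \<in> multi_indices n"
proof -
  \<comment> \<open>Natural exponents cannot cancel, so the supports of the summands both survive in
    the sum.\<close>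
  have "Poly_Mapping.keys (\<mu> + \<nu>) = Poly_Mapping.keys \<mu> \<union> Poly_Mapping.keys \<nu>"
    by (auto simp: in_keys_iff lookup_add)
  then show ?thesis
    by (auto simp: multi_indices_def)
qed

lemma zero_in_multi_indices [simp]: "0 \<in> multi_indices n"
  by (simp add: multi_indices_def)

lemma splittings_0 [simp]: "splittings 0 = {(0, 0)}"
proof -
  have *: "\<beta> = 0 \<and> \<gamma> = 0" if "\<beta> + \<gamma> = 0" for \<beta> \<gamma> :: multi_index
    using that by (metis add_is_0 mdeg_add mdeg_eq_0_iff)
  show ?thesis
    by (auto simp: splittings_def dest: *)
qed

section \<open>Coefficients of the ring operations\<close>

lemma mfps_nth_0 [simp]: "mfps_nth 0 \<alpha> = 0"
  by transfer simp

lemma mfps_nth_1: "mfps_nth 1 \<alpha> = (if \<alpha> = 0 then 1 else 0)"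
  by transfer simp

lemma mfps_nth_add [simp]: "mfps_nth (f + g) \<alpha> = mfps_nth f \<alpha> + mfps_nth g \<alpha>"
  by transfer simp

lemma mfps_nth_diff [simp]: "mfps_nth (f - g) \<alpha> = mfps_nth f \<alpha> - mfps_nth g \<alpha>"
  by transfer simp

lemma mfps_nth_mult:
  "mfps_nth (f * g) \<alpha> = (\<Sum>(\<beta>, \<gamma>)\<in>splittings \<alpha>. mfps_nth f \<beta> * mfps_nth g \<gamma>)"
  by transfer simp

lemma mfps_nth_mult_0 [simp]: "mfps_nth (f * g) 0 = mfps_nth f 0 * mfps_nth g 0"
  by (simp add: mfps_nth_mult)

lemma mfps_nth_const: "mfps_nth (mfps_const c) \<alpha> = (if \<alpha> = 0 then c else 0)"
  by (simp add: mfps_const_def mfps_nth_monom)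

lemma mfps_nth_const_mult [simp]: "mfps_nth (mfps_const c * f) \<alpha> = c * mfps_nth f \<alpha>"
proof -
  have "mfps_nth (mfps_const c * f) \<alpha>
        = (\<Sum>(\<beta>, \<gamma>)\<in>{(0, \<alpha>)}. mfps_nth (mfps_const c) \<beta> * mfps_nth f \<gamma>)"
    unfolding mfps_nth_mult
    by (rule sum.mono_neutral_right[OF finite_splittings])
       (auto simp: splittings_def mfps_nth_const split: if_splits)
  then show ?thesis
    by (simp add: mfps_nth_const)
qed

text \<open>This says that the order of \<open>f\<close> is at least \<open>d\<close>; phrased as a
  bound, it gives the zero series no special value.\<close>

definition vanishes_below :: "nat \<Rightarrow> 'a::comm_ring_1 mfps \<Rightarrow> bool" where
  "vanishes_below d f \<longleftrightarrow> (\<forall>\<alpha>. mdeg \<alpha> < d \<longrightarrow> mfps_nth f \<alpha> = 0)"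

lemma vanishes_below_0 [simp]: "vanishes_below 0 f"
  by (simp add: vanishes_below_def)

lemma vanishes_below_mult:
  assumes "vanishes_below d f" "vanishes_below e g"
  shows "vanishes_below (d + e) (f * g)"
  unfolding vanishes_below_def mfps_nth_mult
proof (intro allI impI sum.neutral ballI, clarify)
  fix \<alpha> \<beta> \<gamma> assume "mdeg \<alpha> < d + e" "(\<beta>, \<gamma>) \<in> splittings \<alpha>"
  then have "mdeg \<beta> < d \<or> mdeg \<gamma> < e"
    by (auto simp: splittings_def mdeg_add)
  then show "mfps_nth f \<beta> * mfps_nth g \<gamma> = 0"
    using assms by (auto simp: vanishes_below_def)
qed

lemma vanishes_below_power:
  assumes "vanishes_below d f"
  shows "vanishes_below (k * d) (f ^ k)"
  by (induction k) (auto intro: vanishes_below_mult assms)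

lemma vanishes_below_prod:
  assumes "\<And>i. i \<in> A \<Longrightarrow> vanishes_below (d i) (f i)"
  shows "vanishes_below (\<Sum>i\<in>A. d i) (\<Prod>i\<in>A. f i)"
  using assms by (induction A rule: infinite_finite_induct) (auto intro: vanishes_below_mult)

lemma vanishes_below_1_iff: "vanishes_below 1 f \<longleftrightarrow> mfps_nth f 0 = 0"
  by (simp add: vanishes_below_def)

text \<open>Induction on the total degree of \<alpha>: every splitting other than (\<alpha>, 0) has
  a first part of smaller degree, where \<open>f\<close> already vanishes. What remains is the
  coefficient of \<open>f\<close> at \<alpha> times the nonzero constant term of
  \<open>g\<close>.\<close>

lemma mfps_mult_eq_0_cancel:
  fixes f g :: "'a::idom mfps"
  assumes "f * g = 0" "mfps_nth g 0 \<noteq> 0"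
  shows "f = 0"
proof (rule mfps_eqI)
  fix \<alpha>
  show "mfps_nth f \<alpha> = mfps_nth 0 \<alpha>"
  proof (induction "mdeg \<alpha>" arbitrary: \<alpha> rule: less_induct)
    case less
    have "0 = (\<Sum>(\<beta>, \<gamma>)\<in>splittings \<alpha>. mfps_nth f \<beta> * mfps_nth g \<gamma>)"
      by (simp flip: mfps_nth_mult add: assms(1))
    also have "\<dots> = (\<Sum>(\<beta>, \<gamma>)\<in>{(\<alpha>, 0)}. mfps_nth f \<beta> * mfps_nth g \<gamma>)"
    proof (rule sum.mono_neutral_right[OF finite_splittings])
      show "{(\<alpha>, 0)} \<subseteq> splittings \<alpha>"
        by (simp add: splittings_def)
      show "\<forall>p\<in>splittings \<alpha> - {(\<alpha>, 0)}. (case p of (\<beta>, \<gamma>) \<Rightarrow> mfps_nth f \<beta> * mfps_nth g \<gamma>) = 0"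
      proof (rule ballI, simp only: split_paired_all prod.case)
        fix \<beta> \<gamma> assume "(\<beta>, \<gamma>) \<in> splittings \<alpha> - {(\<alpha>, 0)}"
        then have p: "(\<beta>, \<gamma>) \<in> splittings \<alpha>" and "\<gamma> \<noteq> 0"
          by (auto simp: splittings_def)
        with p have "mdeg \<beta> < mdeg \<alpha>"
          by (auto simp: splittings_def mdeg_add)
        then show "mfps_nth f \<beta> * mfps_nth g \<gamma> = 0"
          using less by simp
      qed
    qed
    finally show ?case
      using assms(2) by simp
  qed
qed

section \<open>Substitution of power series\<close>

locale mfps_substitution =
  fixes n :: nat and u :: "nat \<Rightarrow> 'a::comm_ring_1 mfps"
  assumes const_term: "j < n \<Longrightarrow> mfps_nth (u j) 0 = 0"
begin

text \<open>The image of the monomial with exponent \<mu> under the substitution of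
  \<open>u j\<close> for the variable \<open>j\<close>.\<close>

definition um :: "multi_index \<Rightarrow> 'a mfps" where
  "um \<mu> = (\<Prod>j<n. u j ^ Poly_Mapping.lookup \<mu> j)"

lemma um_0 [simp]: "um 0 = 1"
  by (simp add: um_def)

lemma um_add: "um (\<mu> + \<nu>) = um \<mu> * um \<nu>"
  by (simp add: um_def lookup_add power_add prod.distrib)

lemma um_single:
  assumes "i < n"
  shows "um (Poly_Mapping.single i 1) = u i"
proof -
  have "um (Poly_Mapping.single i 1) = (\<Prod>j<n. if j = i then u j else 1)"
    unfolding um_def by (intro prod.cong) (auto simp: lookup_single)
  then show ?thesis
    using assms by simp
qed

text \<open>Each \<open>u j\<close> has order at least 1, so a product with total exponent
  \<open>mdeg \<mu>\<close> has at least that order. This makes every coefficient of a substitution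
  a finite sum.\<close>

lemma um_nth_eq_0:
  assumes "\<mu> \<in> multi_indices n" "mdeg \<alpha> < mdeg \<mu>"
  shows "mfps_nth (um \<mu>) \<alpha> = 0"
proof -
  \<comment> \<open>The factor \<open>* 1\<close> gives the exponents the shape of
    \<open>vanishes_below_power\<close> with order 1.\<close>
  have "vanishes_below (\<Sum>j<n. Poly_Mapping.lookup \<mu> j * 1) (um \<mu>)"
    unfolding um_def
    by (intro vanishes_below_prod vanishes_below_power)
       (simp add: vanishes_below_1_iff const_term del: One_nat_def)
  then show ?thesis
    using assms by (simp add: vanishes_below_def mdeg_eq_sum)
qed

lemma nonzero_subset:
  "{\<mu> \<in> multi_indices n. mfps_nth (mfps_const (mfps_nth f \<mu>) * um \<mu>) \<alpha> \<noteq> 0}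
     \<subseteq> {\<mu> \<in> multi_indices n. mdeg \<mu> \<le> mdeg \<alpha>}"
  using um_nth_eq_0 by (force simp: not_less[symmetric])

lemma summable: "mfps_summable (\<lambda>\<mu>. mfps_const (mfps_nth f \<mu>) * um \<mu>) (multi_indices n)"
  unfolding mfps_summable_def
  by (intro allI finite_subset[OF nonzero_subset] finite_multi_indices_mdeg_le)

text \<open>The truncation bound \<open>d\<close> stays free so that coefficients of different
  degrees can share one finite index set, as \<open>subst_mult\<close> requires.\<close>

lemma nth_subst:
  assumes "mdeg \<alpha> \<le> d"
  shows "mfps_nth (mfps_subst n f u) \<alpha> =
    (\<Sum>\<mu>\<in>{\<mu> \<in> multi_indices n. mdeg \<mu> \<le> d}. mfps_nth f \<mu> * mfps_nth (um \<mu>) \<alpha>)"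
proof -
  have "mfps_nth (mfps_subst n f u) \<alpha> =
    (\<Sum>\<mu>\<in>{\<mu> \<in> multi_indices n. mfps_nth (mfps_const (mfps_nth f \<mu>) * um \<mu>) \<alpha> \<noteq> 0}.
      mfps_nth (mfps_const (mfps_nth f \<mu>) * um \<mu>) \<alpha>)"
    by (simp only: mfps_subst_def mfps_sum_def Abs_mfps_inverse[OF UNIV_I] um_def)
  also have "\<dots> = (\<Sum>\<mu>\<in>{\<mu> \<in> multi_indices n. mdeg \<mu> \<le> d}.
      mfps_nth (mfps_const (mfps_nth f \<mu>) * um \<mu>) \<alpha>)"
    using nonzero_subset assms
    by (intro sum.mono_neutral_left finite_multi_indices_mdeg_le) fastforce+
  finally show ?thesis
    by simp
qed

lemma subst_add: "mfps_subst n (f + g) u = mfps_subst n f u + mfps_subst n g u"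
  by (rule mfps_eqI) (simp add: nth_subst[OF order_refl] sum.distrib algebra_simps)

lemma subst_const: "mfps_subst n (mfps_const c) u = mfps_const c"
proof (rule mfps_eqI)
  fix \<alpha>
  let ?B = "{\<mu> \<in> multi_indices n. mdeg \<mu> \<le> mdeg \<alpha>}"
  have "mfps_nth (mfps_subst n (mfps_const c) u) \<alpha> =
        (\<Sum>\<mu>\<in>?B. if \<mu> = 0 then c * mfps_nth (um 0) \<alpha> else 0)"
    unfolding nth_subst[OF order_refl] by (intro sum.cong) (auto simp: mfps_nth_const)
  also have "\<dots> = mfps_nth (mfps_const c) \<alpha>"
    by (simp add: sum.delta finite_multi_indices_mdeg_le mfps_nth_const mfps_nth_1)
  finally show "mfps_nth (mfps_subst n (mfps_const c) u) \<alpha> = mfps_nth (mfps_const c) \<alpha>" .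
qed

lemma subst_X:
  assumes "i < n"
  shows "mfps_subst n (mfps_X i) u = u i"
proof (rule mfps_eqI)
  fix \<alpha>
  let ?s = "Poly_Mapping.single i (1::nat)"
  \<comment> \<open>At \<alpha> = 0 a truncation at degree 0 would miss the index \<open>?s\<close>
    of degree 1.\<close>
  let ?d = "max 1 (mdeg \<alpha>)"
  let ?B = "{\<mu> \<in> multi_indices n. mdeg \<mu> \<le> ?d}"
  have s: "?s \<in> ?B"
    using assms by (auto simp: multi_indices_def mdeg_def)
  have "mfps_nth (mfps_subst n (mfps_X i) u) \<alpha> =
        (\<Sum>\<mu>\<in>?B. if \<mu> = ?s then mfps_nth (um ?s) \<alpha> else 0)"
    unfolding nth_subst[OF max.cobounded2[of "mdeg \<alpha>" 1]] mfps_X_def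
    by (intro sum.cong) (auto simp: mfps_nth_monom)
  also have "\<dots> = mfps_nth (u i) \<alpha>"
    unfolding sum.delta[OF finite_multi_indices_mdeg_le] using s um_single[OF assms] by simp
  finally show "mfps_nth (mfps_subst n (mfps_X i) u) \<alpha> = mfps_nth (u i) \<alpha>" .
qed

text \<open>Both sides are sums over pairs (\<mu>, \<nu>) of the same terms. The left one runs over
  the triangle of pairs of total degree at most \<open>mdeg \<alpha>\<close>, the right one over the
  full square \<open>?B \<times> ?B\<close>.\<close>

lemma subst_mult: "mfps_subst n (f * g) u = mfps_subst n f u * mfps_subst n g u"
proof (rule mfps_eqI)
  fix \<alpha>
  let ?B = "{\<mu> \<in> multi_indices n. mdeg \<mu> \<le> mdeg \<alpha>}"
  let ?t = "\<lambda>(\<mu>, \<nu>). mfps_nth f \<mu> * mfps_nth g \<nu> * mfps_nth (um (\<mu> + \<nu>)) \<alpha>"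
  note fin = finite_multi_indices_mdeg_le[of n "mdeg \<alpha>"]
  have "mfps_nth (mfps_subst n (f * g) u) \<alpha> = (\<Sum>\<kappa>\<in>?B. \<Sum>p\<in>splittings \<kappa>. ?t p)"
    unfolding nth_subst[OF order_refl] mfps_nth_mult sum_distrib_right
    by (intro sum.cong) (auto simp: splittings_def)
  also have "\<dots> = (\<Sum>(\<kappa>, p)\<in>Sigma ?B splittings. ?t p)"
    by (subst sum.Sigma) (auto simp: fin)
  also have "\<dots> = (\<Sum>p\<in>{(\<mu>, \<nu>). \<mu> + \<nu> \<in> ?B}. ?t p)"
    by (rule sum.reindex_bij_witness[of _ "\<lambda>p. (fst p + snd p, p)" snd])
       (auto simp: splittings_def)
  \<comment> \<open>Pairs of the square outside the triangle have total degree above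
    \<open>mdeg \<alpha>\<close>, so \<open>um_nth_eq_0\<close> kills their terms.\<close>
  also have "\<dots> = (\<Sum>p\<in>?B \<times> ?B. ?t p)"
  proof (rule sum.mono_neutral_left)
    show "{(\<mu>, \<nu>). \<mu> + \<nu> \<in> ?B} \<subseteq> ?B \<times> ?B"
      by (auto simp: multi_indices_add_iff mdeg_add)
    show "\<forall>p\<in>?B \<times> ?B - {(\<mu>, \<nu>). \<mu> + \<nu> \<in> ?B}. ?t p = 0"
      by clarsimp (metis mult_zero_right multi_indices_add_iff not_le um_nth_eq_0)
  qed (simp add: fin)
  also have "\<dots> = (\<Sum>(\<mu>, \<nu>)\<in>?B \<times> ?B. \<Sum>(\<beta>, \<gamma>)\<in>splittings \<alpha>.
      (mfps_nth f \<mu> * mfps_nth (um \<mu>) \<beta>) * (mfps_nth g \<nu> * mfps_nth (um \<nu>) \<gamma>))"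
    by (intro sum.cong refl)
       (simp add: um_add mfps_nth_mult sum_distrib_left case_prod_unfold mult.assoc mult.left_commute)
  also have "\<dots> = (\<Sum>(\<beta>, \<gamma>)\<in>splittings \<alpha>. \<Sum>(\<mu>, \<nu>)\<in>?B \<times> ?B.
      (mfps_nth f \<mu> * mfps_nth (um \<mu>) \<beta>) * (mfps_nth g \<nu> * mfps_nth (um \<nu>) \<gamma>))"
    unfolding case_prod_unfold by (rule sum.swap)
  also have "\<dots> = (\<Sum>(\<beta>, \<gamma>)\<in>splittings \<alpha>.
      mfps_nth (mfps_subst n f u) \<beta> * mfps_nth (mfps_subst n g u) \<gamma>)"
  proof (intro sum.cong refl, clarify)
    fix \<beta> \<gamma> assume "(\<beta>, \<gamma>) \<in> splittings \<alpha>"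
    then have "mdeg \<beta> \<le> mdeg \<alpha>" "mdeg \<gamma> \<le> mdeg \<alpha>"
      by (auto simp: splittings_def mdeg_add)
    then show "(\<Sum>(\<mu>, \<nu>)\<in>?B \<times> ?B.
        (mfps_nth f \<mu> * mfps_nth (um \<mu>) \<beta>) * (mfps_nth g \<nu> * mfps_nth (um \<nu>) \<gamma>))
      = mfps_nth (mfps_subst n f u) \<beta> * mfps_nth (mfps_subst n g u) \<gamma>"
      by (simp only: nth_subst sum_product sum.cartesian_product)
  qed
  finally show "mfps_nth (mfps_subst n (f * g) u) \<alpha>
      = mfps_nth (mfps_subst n f u * mfps_subst n g u) \<alpha>"
    by (simp add: mfps_nth_mult)
qed

lemma subst_nth_0: "mfps_nth (mfps_subst n f u) 0 = mfps_nth f 0"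
proof -
  have "{\<mu> \<in> multi_indices n. mdeg \<mu> \<le> 0} = {0}"
    by auto
  then show ?thesis
    by (simp add: nth_subst[of 0 0] mfps_nth_1 mdeg_def)
qed

end

section \<open>Uniqueness of extensions along separable algebraic extensions\<close>

text \<open>Ring homomorphisms splitting the constant-term map: the common setting for
  \<open>\<theta>s\<close> and for \<open>\<theta>t\<close> followed by the substitution.\<close>

locale mfps_section =
  fixes \<phi> :: "'a::comm_ring_1 \<Rightarrow> 'a mfps"
  assumes hom_1: "\<phi> 1 = 1"
    and hom_add: "\<phi> (x + y) = \<phi> x + \<phi> y"
    and hom_mult: "\<phi> (x * y) = \<phi> x * \<phi> y"
    and nth_0: "mfps_nth (\<phi> x) 0 = x"
begin

lemma hom_0: "\<phi> 0 = 0"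
  using hom_add[of 0 0] by simp

lemma hom_uminus: "\<phi> (- x) = - \<phi> x"
  using hom_add[of x "- x"] by (simp add: hom_0 eq_neg_iff_add_eq_0 add.commute)

end

lemma higher_derivation_imp_mfps_section: "higher_derivation n \<theta> \<Longrightarrow> mfps_section \<theta>"
  by (simp add: higher_derivation_def mfps_section_def)

section \<open>Agreement on generated subfields\<close>

lemma inv_ring_of_type_algebra:
  fixes x :: "'a::field"
  assumes "x \<noteq> 0"
  shows "inv\<^bsub>(ring_of_type_algebra :: 'a ring)\<^esub> x = inverse x"
proof -
  interpret F: Ring.field "ring_of_type_algebra :: 'a ring"
    by (rule field_from_type_algebra)
  show ?thesis
    using assms by (intro F.comm_inv_char) (auto simp: ring_of_type_algebra_def)
qed

lemma a_inv_ring_of_type_algebra: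
  fixes x :: "'a::field"
  shows "\<ominus>\<^bsub>(ring_of_type_algebra :: 'a ring)\<^esub> x = - x"
proof -
  interpret F: Ring.field "ring_of_type_algebra :: 'a ring"
    by (rule field_from_type_algebra)
  show ?thesis
    by (rule sym, rule F.sum_zero_eq_neg) (auto simp: ring_of_type_algebra_def)
qed

text \<open>The set where two ring homomorphisms agree is closed under the field operations, so
  induction on the generation of \<open>adjoin K S\<close> applies.\<close>

lemma adjoin_agree:
  fixes \<phi> \<psi> :: "'a::field \<Rightarrow> 'a mfps"
  assumes "mfps_section \<phi>" "mfps_section \<psi>"
    and agree: "\<And>x. x \<in> K \<union> S \<Longrightarrow> \<phi> x = \<psi> x"
    and "x \<in> adjoin K S"
  shows "\<phi> x = \<psi> x"
proof -
  interpret \<phi>: mfps_section \<phi> by fact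
  interpret \<psi>: mfps_section \<psi> by fact
  show ?thesis
    using assms(4) unfolding adjoin_def
  proof (induction rule: generate_field.induct)
    case one
    then show ?case
      by (simp add: ring_of_type_algebra_def \<phi>.hom_1 \<psi>.hom_1)
  next
    case (incl h)
    then show ?case
      by (rule agree)
  next
    case (a_inv h)
    then show ?case
      by (simp add: a_inv_ring_of_type_algebra \<phi>.hom_uminus \<psi>.hom_uminus)
  next
    case (m_inv h)
    then have "h \<noteq> 0"
      by (simp add: ring_of_type_algebra_def)
    \<comment> \<open>Both candidates are inverses of the same series, as \<phi> and \<psi> agree at
      \<open>h\<close>; inverses in a commutative ring are unique.\<close>
    then have "\<phi> h * \<phi> (inverse h) = 1" "\<phi> h * \<psi> (inverse h) = 1"
      using \<phi>.hom_mult[of h "inverse h"] \<psi>.hom_mult[of h "inverse h"]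
      by (simp_all add: \<phi>.hom_1 \<psi>.hom_1 m_inv.IH)
    then have "\<phi> (inverse h) = \<psi> (inverse h)"
      using mult.assoc[of "\<phi> (inverse h)" "\<phi> h" "\<psi> (inverse h)"] by (simp add: mult.commute)
    with \<open>h \<noteq> 0\<close> show ?case
      by (simp add: inv_ring_of_type_algebra)
  next
    case (eng_add h1 h2)
    have "h1 \<oplus>\<^bsub>ring_of_type_algebra\<^esub> h2 = h1 + h2"
      by (simp add: ring_of_type_algebra_def)
    then show ?case
      by (simp add: eng_add.IH \<phi>.hom_add \<psi>.hom_add)
  next
    case (eng_mult h1 h2)
    have "h1 \<otimes>\<^bsub>ring_of_type_algebra\<^esub> h2 = h1 * h2"
      by (simp add: ring_of_type_algebra_def)
    then show ?case
      by (simp add: eng_mult.IH \<phi>.hom_mult \<psi>.hom_mult)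
  qed
qed

section \<open>Agreement at separable elements\<close>

text \<open>With equal coefficient images, the difference is P(\<phi> x) - P(\<psi> x) for one
  polynomial P over the power series, and \<open>c\<close> is the divided difference of P. Modulo
  the variables both arguments become \<open>x\<close>, so \<open>c\<close> reduces to the
  derivative.\<close>

lemma diff_poly_eq:
  fixes \<phi> \<psi> :: "'a::idom \<Rightarrow> 'a mfps"
  assumes "mfps_section \<phi>" "mfps_section \<psi>"
    and "\<And>i. \<phi> (poly.coeff p i) = \<psi> (poly.coeff p i)"
  shows "\<exists>c. \<phi> (poly p x) - \<psi> (poly p x) = (\<phi> x - \<psi> x) * c \<and>
    mfps_nth c 0 = poly (pderiv p) x"
proof -
  interpret \<phi>: mfps_section \<phi> by fact
  interpret \<psi>: mfps_section \<psi> by fact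
  show ?thesis
    using assms(3)
  proof (induction p)
    case 0
    show ?case
      by (rule exI[of _ 0]) (simp add: \<phi>.hom_0 \<psi>.hom_0)
  next
    case (pCons a p)
    have "\<phi> (poly.coeff p i) = \<psi> (poly.coeff p i)" for i
      using pCons.prems[of "Suc i"] by simp
    then obtain c where c: "\<phi> (poly p x) - \<psi> (poly p x) = (\<phi> x - \<psi> x) * c"
      and c0: "mfps_nth c 0 = poly (pderiv p) x"
      using pCons.IH by blast
    have "\<phi> a = \<psi> a"
      using pCons.prems[of 0] by simp
    then have "\<phi> (poly (pCons a p) x) - \<psi> (poly (pCons a p) x)
        = (\<phi> x - \<psi> x) * \<phi> (poly p x) + \<psi> x * (\<phi> (poly p x) - \<psi> (poly p x))"
      by (simp add: \<phi>.hom_add \<psi>.hom_add \<phi>.hom_mult \<psi>.hom_mult algebra_simps)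
    \<comment> \<open>The new witness has constant term p(x) + x p'(x), the derivative of a + x
      p(x).\<close>
    also have "\<dots> = (\<phi> x - \<psi> x) * (\<phi> (poly p x) + \<psi> x * c)"
      by (simp add: c algebra_simps)
    finally show ?case
      by (intro exI conjI, assumption)
         (simp add: pderiv_pCons c0 \<phi>.nth_0 \<psi>.nth_0)
  qed
qed

lemma map_poly_to_ac_mult: "map_poly to_ac (p * q) = map_poly to_ac p * map_poly to_ac q"
  by (rule poly_eqI) (simp add: coeff_map_poly coeff_mult to_ac_sum)

text \<open>A common root of \<open>p\<close> and its derivative is a double root; the square factor
  persists in the algebraic closure.\<close>

lemma separable_pderiv_nonzero:
  fixes x :: "'a::field"
  assumes "rsquarefree (map_poly to_ac p)" "poly p x = 0"
  shows "poly (pderiv p) x \<noteq> 0"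
proof
  assume *: "poly (pderiv p) x = 0"
  obtain q where q: "p = [:- x, 1:] * q"
    using assms(2) by (auto simp: poly_eq_0_iff_dvd)
  have "poly q x = 0"
    using * unfolding q pderiv_mult by (simp add: pderiv_pCons)
  then obtain r where "q = [:- x, 1:] * r"
    by (auto simp: poly_eq_0_iff_dvd)
  then have "p = [:- x, 1:] * [:- x, 1:] * r"
    by (simp only: q mult.assoc)
  then have "map_poly to_ac p = [:- to_ac x, 1:] ^ 2 * map_poly to_ac r"
    by (simp only: map_poly_to_ac_mult power2_eq_square) (simp add: map_poly_pCons)
  then have "[:- to_ac x, 1:] ^ 2 dvd map_poly to_ac p"
    by simp
  then show False
    using assms(1) unfolding order_divides rsquarefree_def
    by (metis One_nat_def Suc_1 not_less_eq_eq not_numeral_le_zero order_refl)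
qed

lemma separable_agree:
  fixes \<phi> \<psi> :: "'a::field \<Rightarrow> 'a mfps"
  assumes \<phi>: "mfps_section \<phi>" and \<psi>: "mfps_section \<psi>"
    and agree: "\<And>y. y \<in> L \<Longrightarrow> \<phi> y = \<psi> y"
    and "separable_over L x"
  shows "\<phi> x = \<psi> x"
proof -
  obtain p where p: "min_poly_over L x p" "rsquarefree (map_poly to_ac p)"
    using assms(4) by (auto simp: separable_over_def)
  then have root: "poly p x = 0" and "\<And>i. \<phi> (poly.coeff p i) = \<psi> (poly.coeff p i)"
    by (auto simp: min_poly_over_def agree)
  from diff_poly_eq[OF \<phi> \<psi> this(2)] obtain c
    where c: "\<phi> (poly p x) - \<psi> (poly p x) = (\<phi> x - \<psi> x) * c"
      and c0: "mfps_nth c 0 = poly (pderiv p) x"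
    by blast
  have "(\<phi> x - \<psi> x) * c = 0"
    using c by (simp add: root mfps_section.hom_0[OF \<phi>] mfps_section.hom_0[OF \<psi>])
  then have "\<phi> x - \<psi> x = 0"
    by (rule mfps_mult_eq_0_cancel) (simp add: c0 separable_pderiv_nonzero[OF p(2) root])
  then show ?thesis
    by simp
qed

text \<open>A series in \<open>n\<close> variables is the sum of its monomials; omitting the index 0
  removes the constant term. This identifies the inner sums of the theorem with
  \<open>\<theta>s (t j) - mfps_const (t j)\<close>.\<close>

lemma mfps_sum_monom_nonzero:
  assumes "f \<in> mfps_carrier n"
  shows "mfps_sum (\<lambda>\<nu>. mfps_monom (mfps_nth f \<nu>) \<nu>) (multi_indices n - {0})
    = f - mfps_const (mfps_nth f 0)"
  using assms
  by (intro mfps_eqI) (auto simp: mfps_nth_sum_monom mfps_nth_const mfps_carrier_def)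

theorem theorem4p1:
  fixes K :: "'a::field set" and n :: nat and t s :: "nat \<Rightarrow> 'a"
    and \<theta>t \<theta>s :: "'a \<Rightarrow> 'a mfps" and g :: 'a
  assumes "is_subfield K"
    and "separating_transcendence_basis K n t"
    and "separating_transcendence_basis K n s"
    and "basis_derivation K n t \<theta>t"
    and "basis_derivation K n s \<theta>s"
  shows "\<theta>s g = mfps_subst n (\<theta>t g) (\<lambda>j. \<theta>s (t j) - mfps_const (t j)) \<and>
    mfps_has_sum
      (\<lambda>\<mu>. mfps_const (mfps_nth (\<theta>t g) \<mu>) *
         (\<Prod>j<n. mfps_sum (\<lambda>\<nu>. mfps_monom (mfps_nth (\<theta>s (t j)) \<nu>) \<nu>)
                    (multi_indices n - {0}) ^ Poly_Mapping.lookup \<mu> j))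
      (multi_indices n) (\<theta>s g)"
proof -
  define u where "u = (\<lambda>j. \<theta>s (t j) - mfps_const (t j))"
  have hd_t: "higher_derivation n \<theta>t" and hd_s: "higher_derivation n \<theta>s"
    using assms(4,5) by (auto simp: basis_derivation_def)
  interpret \<theta>t: mfps_section \<theta>t
    by (rule higher_derivation_imp_mfps_section[OF hd_t])
  interpret \<theta>s: mfps_section \<theta>s
    by (rule higher_derivation_imp_mfps_section[OF hd_s])
  interpret mfps_substitution n u
    by unfold_locales (simp add: u_def \<theta>s.nth_0 mfps_nth_const)
  have one: "mfps_const (1::'a) = 1"
    by (rule mfps_eqI) (simp add: mfps_nth_const mfps_nth_1)
  have subst: "mfps_section (\<lambda>x. mfps_subst n (\<theta>t x) u)"
    using subst_const[of 1]
    by unfold_locales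
       (simp_all add: one \<theta>t.hom_1 \<theta>t.hom_add \<theta>t.hom_mult \<theta>t.nth_0
          subst_add subst_mult subst_nth_0)
  \<comment> \<open>On \<open>K\<close> both sides are constant series. At \<open>t j\<close> the
    substitution turns \<open>mfps_const (t j) + mfps_X j\<close> into
    \<open>mfps_const (t j) + u j\<close>, which is \<open>\<theta>s (t j)\<close>.\<close>
  have "\<theta>s x = mfps_subst n (\<theta>t x) u" if "x \<in> K \<union> t ` {..<n}" for x
    using that assms(4,5)
    by (auto simp: basis_derivation_def subst_add subst_const subst_X u_def[THEN fun_cong])
  then have "\<theta>s x = mfps_subst n (\<theta>t x) u" if "x \<in> adjoin K (t ` {..<n})" for x
    using adjoin_agree[OF \<theta>s.mfps_section_axioms subst] that by blast
  moreover have "separable_over (adjoin K (t ` {..<n})) g"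
    using assms(2) by (simp add: separating_transcendence_basis_def)
  ultimately have eq: "\<theta>s g = mfps_subst n (\<theta>t g) u"
    by (rule separable_agree[OF \<theta>s.mfps_section_axioms subst])
  have "mfps_sum (\<lambda>\<nu>. mfps_monom (mfps_nth (\<theta>s (t j)) \<nu>) \<nu>) (multi_indices n - {0}) = u j" for j
    using hd_s by (simp add: u_def higher_derivation_def mfps_sum_monom_nonzero)
  \<comment> \<open>The substitution is by definition the sum of this family, so only its
    summability has to be added to \<open>eq\<close>.\<close>
  then show ?thesis
    using eq summable[of "\<theta>t g", unfolded um_def]
    by (simp add: mfps_has_sum_def mfps_subst_def u_def)
qed

end
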